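(* Let $G=(V,E)$ be a finite graph with arbitrary real coupling constants $(J_e)_{e\in E}$ and $(U_e)_{e\in E}$. Let $A_1,A_2,B_1,B_2\subseteq V$ be pairwise disjoint, and let $A=A_1\cup A_2$, $B=B_1\cup B_2$. Then in the Ashkin--Teller model on $G$, $$\langle\varphi_{A_1}\varphi^2_{A_2}\tilde\varphi_{B_1}\tilde\varphi^2_{B_2}\rangle=\frac1{Z_\emptyset}\sum_{\mathbf n=(\omega,\eta)\in\Omega_{A_1\cup B_1}}w(\mathbf n)\,2^{-k_{A\cup B}(\omega)}\,\mathbf 1\{A\not\leftrightarrow_\omega B\},$$ where $k_{A\cup B}(\omega)$ is the number of connected components of $(V,\omega)$ intersecting $A\cup B$, and $A\not\leftrightarrow_\omega B$ means that no vertex of $A$ is connected to a vertex of $B$ by a path of edges in $\omega$.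
   Context: The Ashkin--Teller model (free boundary conditions) on a finite graph $G=(V,E)$ with real coupling constants $J_e,U_e$ is the probability measure on pairs $(\sigma,\tilde\sigma)\in\{-1,1\}^V\times\{-1,1\}^V$ given by $$\mathbf P(\sigma,\tilde\sigma)=\frac1{\mathcal Z}\prod_{uv\in E}\exp\big(J_{uv}(\sigma_u\sigma_v+\tilde\sigma_u\tilde\sigma_v)+U_{uv}(\sigma_u\sigma_v\tilde\sigma_u\tilde\sigma_v+1)\big),$$ with $\mathcal Z$ the normalizing constant; $\langle\cdot\rangle$ is the expectation. Define $\varphi_v=(\sigma_v+\tilde\sigma_v)/2$ and $\tilde\varphi_v=(\sigma_v-\tilde\sigma_v)/2$. For $A\subseteq V$, $\varphi_A=\prod_{v\in A}\varphi_v$, $\varphi_A^2=\prod_{v\in A}\varphi_v^2$, and similarly for $\tilde\varphi$ (empty products equal $1$). Currents: for $\eta\subseteq E$, $\delta(\eta)$ is the set of vertices of odd degree in $(V,\eta)$. A current with sources $A\subseteq V$ is a pair $\mathbf n=(\omega,\eta)$ with $\eta\subseteq\omega\subseteq E$ and $\delta(\eta)=A$. $\Omega_A$ is the set of all currents with sources $A$ if $|A|$ is even, and $\Omega_A=\emptyset$ otherwise. The weight of a current is $$w(\mathbf n)=2^{k(\omega)}\prod_{e\in\eta}x_e\prod_{e\in\omega\setminus\eta}y_e,\qquad x_e=e^{2U_e}\sinh(2J_e),\quad y_e=e^{2U_e}\cosh(2J_e)-1,$$ where $k(\omega)$ is the number of connected components of $(V,\omega)$, including isolated vertices. $Z_\emptyset=\sum_{\mathbf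 n\in\Omega_\emptyset}w(\mathbf n)$. *)

theory Defs
  imports "HOL-Probability.Probability"
begin

text \<open>A finite simple graph: an edge \<open>uv\<close> is the two-element set \<open>{u, v}\<close>, so that for
  \<open>e = {u, v}\<close> the product \<open>\<sigma>\<^sub>u \<sigma>\<^sub>v\<close> is \<open>\<Prod>v\<in>e. \<sigma> v\<close>.\<close>

definition finite_graph :: "'v set \<Rightarrow> 'v set set \<Rightarrow> bool" where
  "finite_graph V E \<longleftrightarrow> finite V \<and> (\<forall>e\<in>E. e \<subseteq> V \<and> card e = 2)"

definition spins :: "'v set \<Rightarrow> ('v \<Rightarrow> real) set" where
  "spins V = (V \<rightarrow>\<^sub>E {-1, 1})"

definition AT_weight ::
  "'v set set \<Rightarrow> ('v set \<Rightarrow> real) \<Rightarrow> ('v set \<Rightarrow> real) \<Rightarrow> ('v \<Rightarrow> real) \<times> ('v \<Rightarrow> real) \<Rightarrow> real" where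
  "AT_weight E J U = (\<lambda>(\<sigma>, \<sigma>').
     \<Prod>e\<in>E. exp (J e * ((\<Prod>v\<in>e. \<sigma> v) + (\<Prod>v\<in>e. \<sigma>' v))
                + U e * ((\<Prod>v\<in>e. \<sigma> v) * (\<Prod>v\<in>e. \<sigma>' v) + 1)))"

definition AT_partition ::
  "'v set \<Rightarrow> 'v set set \<Rightarrow> ('v set \<Rightarrow> real) \<Rightarrow> ('v set \<Rightarrow> real) \<Rightarrow> real" where
  "AT_partition V E J U = (\<Sum>s \<in> spins V \<times> spins V. AT_weight E J U s)"

definition AT_measure ::
  "'v set \<Rightarrow> 'v set set \<Rightarrow> ('v set \<Rightarrow> real) \<Rightarrow> ('v set \<Rightarrow> real)
     \<Rightarrow> (('v \<Rightarrow> real) \<times> ('v \<Rightarrow> real)) measure" where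
  "AT_measure V E J U =
     point_measure (spins V \<times> spins V) (\<lambda>s. ennreal (AT_weight E J U s / AT_partition V E J U))"

lemma prob_space_AT_measure:
  assumes "finite V"
  shows "prob_space (AT_measure V E J U)"
proof (rule prob_spaceI)
  let ?S = "spins V \<times> spins V"
  have fin: "finite ?S"
    using assms by (auto simp: spins_def intro: finite_PiE)
  have pos: "AT_weight E J U s > 0" for s
    by (auto simp: AT_weight_def split: prod.split intro!: prod_pos)
  have "?S \<noteq> {}"
    by (auto simp: spins_def PiE_eq_empty_iff)
  then have Z: "AT_partition V E J U > 0"
    unfolding AT_partition_def using fin pos by (intro sum_pos) auto
  have "emeasure (AT_measure V E J U) (space (AT_measure V E J U))
      = (\<Sum>s\<in>?S. ennreal (AT_weight E J U s / AT_partition V E J U))"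
    using fin by (simp add: AT_measure_def space_point_measure emeasure_point_measure_finite)
  also have "\<dots> = ennreal (\<Sum>s\<in>?S. AT_weight E J U s / AT_partition V E J U)"
    using pos Z by (intro sum_ennreal) (simp add: less_imp_le)
  also have "(\<Sum>s\<in>?S. AT_weight E J U s / AT_partition V E J U) = 1"
    using Z by (simp add: sum_divide_distrib[symmetric] AT_partition_def)
  finally show "emeasure (AT_measure V E J U) (space (AT_measure V E J U)) = 1"
    by simp
qed

definition AT_expectation ::
  "'v set \<Rightarrow> 'v set set \<Rightarrow> ('v set \<Rightarrow> real) \<Rightarrow> ('v set \<Rightarrow> real)
     \<Rightarrow> (('v \<Rightarrow> real) \<times> ('v \<Rightarrow> real) \<Rightarrow> real) \<Rightarrow> real" where
  "AT_expectation V E J U f = integral\<^sup>L (AT_measure V E J U) f"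

definition phi :: "('v \<Rightarrow> real) \<times> ('v \<Rightarrow> real) \<Rightarrow> 'v \<Rightarrow> real" where
  "phi s v = (fst s v + snd s v) / 2"

definition phi' :: "('v \<Rightarrow> real) \<times> ('v \<Rightarrow> real) \<Rightarrow> 'v \<Rightarrow> real" where
  "phi' s v = (fst s v - snd s v) / 2"

definition odd_vertices :: "'v set \<Rightarrow> 'v set set \<Rightarrow> 'v set" where
  "odd_vertices V \<eta> = {v \<in> V. odd (card {e \<in> \<eta>. v \<in> e})}"

definition currents :: "'v set \<Rightarrow> 'v set set \<Rightarrow> 'v set \<Rightarrow> ('v set set \<times> 'v set set) set" where
  "currents V E A =
     (if even (card A) then {(\<omega>, \<eta>). \<eta> \<subseteq> \<omega> \<and> \<omega> \<subseteq> E \<and> odd_vertices V \<eta> = A} else {})"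

definition connected_in :: "'v set set \<Rightarrow> 'v \<Rightarrow> 'v \<Rightarrow> bool" where
  "connected_in \<omega> u v \<longleftrightarrow> (u, v) \<in> {(a, b). {a, b} \<in> \<omega>}\<^sup>*"

definition graph_components :: "'v set \<Rightarrow> 'v set set \<Rightarrow> 'v set set" where
  "graph_components V \<omega> = V // {(u, v) \<in> V \<times> V. connected_in \<omega> u v}"

definition num_components :: "'v set \<Rightarrow> 'v set set \<Rightarrow> nat" where
  "num_components V \<omega> = card (graph_components V \<omega>)"

definition num_components_meeting :: "'v set \<Rightarrow> 'v set \<Rightarrow> 'v set set \<Rightarrow> nat" where
  "num_components_meeting V S \<omega> = card {C \<in> graph_components V \<omega>. C \<inter> S \<noteq> {}}"

definition not_connected_sets :: "'v set set \<Rightarrow> 'v set \<Rightarrow> 'v set \<Rightarrow> bool" where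
  "not_connected_sets \<omega> A B \<longleftrightarrow> (\<forall>a\<in>A. \<forall>b\<in>B. \<not> connected_in \<omega> a b)"

definition x_weight :: "('v set \<Rightarrow> real) \<Rightarrow> ('v set \<Rightarrow> real) \<Rightarrow> 'v set \<Rightarrow> real" where
  "x_weight J U e = exp (2 * U e) * sinh (2 * J e)"

definition y_weight :: "('v set \<Rightarrow> real) \<Rightarrow> ('v set \<Rightarrow> real) \<Rightarrow> 'v set \<Rightarrow> real" where
  "y_weight J U e = exp (2 * U e) * cosh (2 * J e) - 1"

definition current_weight ::
  "'v set \<Rightarrow> ('v set \<Rightarrow> real) \<Rightarrow> ('v set \<Rightarrow> real) \<Rightarrow> 'v set set \<times> 'v set set \<Rightarrow> real" where
  "current_weight V J U = (\<lambda>(\<omega>, \<eta>).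
     2 ^ num_components V \<omega> * (\<Prod>e\<in>\<eta>. x_weight J U e) * (\<Prod>e\<in>\<omega> - \<eta>. y_weight J U e))"

definition current_partition ::
  "'v set \<Rightarrow> 'v set set \<Rightarrow> ('v set \<Rightarrow> real) \<Rightarrow> ('v set \<Rightarrow> real) \<Rightarrow> real" where
  "current_partition V E J U = (\<Sum>n \<in> currents V E {}. current_weight V J U n)"

end

theory Submission
  imports Defs
begin

text \<open>In terms of \<open>\<tau> = \<sigma> \<sigma>'\<close>, the field \<open>\<phi>\<close> is \<open>\<sigma>\<close> where \<open>\<tau> = 1\<close> and vanishes elsewhere, \<open>\<phi>'\<close> is \<open>\<sigma>\<close>
  where \<open>\<tau> = -1\<close> and vanishes elsewhere, and the weight of an edge \<open>e = uv\<close> is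
  \<open>1 + 1{\<tau>\<^sub>u = \<tau>\<^sub>v} (y\<^sub>e + x\<^sub>e \<sigma>\<^sub>u \<sigma>\<^sub>v)\<close>. Expanding the product over edges gives a sum over pairs
  \<open>\<eta> \<subseteq> \<omega>\<close>, in which \<open>\<sigma>\<close> and \<open>\<tau>\<close> decouple: the sum over \<open>\<sigma>\<close> selects the sources of \<open>\<eta>\<close>, and the sum
  over \<open>\<tau>\<close> counts the \<open>\<plusminus>1\<close> colourings of the components of \<open>\<omega>\<close> that are \<open>1\<close> on \<open>A\<close> and \<open>-1\<close> on \<open>B\<close>.\<close>

section \<open>Spin configurations and finite graphs\<close>

lemma finite_spins: "finite V \<Longrightarrow> finite (spins V)"
  by (auto simp: spins_def intro: finite_PiE)

lemma spinsD: "\<sigma> \<in> spins V \<Longrightarrow> v \<in> V \<Longrightarrow> \<sigma> v = -1 \<or> \<sigma> v = 1"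
  by (auto simp: spins_def)

lemma spins_times_self: "\<sigma> \<in> spins V \<Longrightarrow> v \<in> V \<Longrightarrow> \<sigma> v * \<sigma> v = 1"
  by (auto dest: spinsD)

lemma finite_graph_finite_edges: "finite_graph V E \<Longrightarrow> finite E"
  unfolding finite_graph_def by (meson PowI finite_Pow_iff finite_subset subsetI)

lemma finite_graph_subset: "finite_graph V E \<Longrightarrow> \<omega> \<subseteq> E \<Longrightarrow> finite_graph V \<omega>"
  unfolding finite_graph_def by auto

lemma prod_of_bool:
  "finite A \<Longrightarrow> (\<Prod>a\<in>A. of_bool (P a) :: 'a :: comm_semiring_1) = of_bool (\<forall>a\<in>A. P a)"
  by (induction A rule: finite_induct) auto

subsection \<open>Connected components and monochromatic edges\<close>

lemma connected_in_sym: "connected_in \<omega> u v \<Longrightarrow> connected_in \<omega> v u"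
proof -
  have "sym {(a, b). {a, b} \<in> \<omega>}"
    by (auto simp: sym_def insert_commute)
  then show "connected_in \<omega> u v \<Longrightarrow> connected_in \<omega> v u"
    unfolding connected_in_def by (meson sym_rtrancl symD)
qed

lemma connected_in_trans: "connected_in \<omega> u v \<Longrightarrow> connected_in \<omega> v w \<Longrightarrow> connected_in \<omega> u w"
  unfolding connected_in_def by (rule rtrancl_trans)

lemma equiv_connected_in: "equiv V {(u, v) \<in> V \<times> V. connected_in \<omega> u v}"
proof (rule equivI)
  show "refl_on V {(u, v) \<in> V \<times> V. connected_in \<omega> u v}"
    by (auto simp: refl_on_def connected_in_def)
  show "sym {(u, v) \<in> V \<times> V. connected_in \<omega> u v}"
    by (auto simp: sym_def dest: connected_in_sym)
  show "trans {(u, v) \<in> V \<times> V. connected_in \<omega> u v}"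
    by (auto simp: trans_def dest: connected_in_trans)
qed auto

text \<open>Quantifying over all pairs in \<open>e\<close> avoids naming the two endpoints of an
  edge given as a set.\<close>

definition monochromatic :: "('v \<Rightarrow> 'c) \<Rightarrow> 'v set \<Rightarrow> bool" where
  "monochromatic \<tau> e \<longleftrightarrow> (\<forall>u\<in>e. \<forall>v\<in>e. \<tau> u = \<tau> v)"

lemma monochromatic_imp_eq_if_connected_in:
  assumes "\<forall>e\<in>\<omega>. monochromatic \<tau> e" "connected_in \<omega> u v"
  shows "\<tau> u = \<tau> v"
  using assms(2) unfolding connected_in_def
proof (induction rule: rtrancl_induct)
  case (step y z)
  then have "monochromatic \<tau> {y, z}" using assms(1) by auto
  then have "\<tau> y = \<tau> z" unfolding monochromatic_def by blast
  with step.IH show ?case by (rule trans)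
qed auto

lemma finite_graph_components: "finite V \<Longrightarrow> finite (graph_components V \<omega>)"
  unfolding graph_components_def by (rule finite_quotient) auto

text \<open>Such a configuration is constant on each component of \<open>\<omega>\<close>, so it
  amounts to one sign per component. The sign is forced on components meeting \<open>A\<close> or
  \<open>B\<close> and free on the others, and a component meeting both leaves no admissible
  configuration.\<close>

lemma card_monochromatic_spins:
  assumes "finite_graph V \<omega>" "A \<subseteq> V" "B \<subseteq> V"
  shows "real (card {\<tau> \<in> spins V. (\<forall>e\<in>\<omega>. monochromatic \<tau> e) \<and> (\<forall>a\<in>A. \<tau> a = 1) \<and> (\<forall>b\<in>B. \<tau> b = -1)})
       = 2 ^ num_components V \<omega> * 2 powi (- int (num_components_meeting V (A \<union> B) \<omega>))
         * of_bool (not_connected_sets \<omega> A B)"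
    (is "real (card ?T) = _")
proof (cases "not_connected_sets \<omega> A B")
  case False
  then obtain a b where ab: "a \<in> A" "b \<in> B" "connected_in \<omega> a b"
    by (auto simp: not_connected_sets_def)
  have "?T = {}"
  proof (rule ccontr)
    assume "?T \<noteq> {}"
    then obtain \<tau> where "\<tau> \<in> ?T" by auto
    with ab monochromatic_imp_eq_if_connected_in[of \<omega> \<tau> a b] have "(1::real) = -1" by auto
    then show False by simp
  qed
  then show ?thesis unfolding \<open>?T = {}\<close> using False by simp
next
  case True
  define R where "R = {(u, v) \<in> V \<times> V. connected_in \<omega> u v}"
  define K where "K = graph_components V \<omega>"
  have finV: "finite V" and edges: "\<And>e. e \<in> \<omega> \<Longrightarrow> e \<subseteq> V \<and> card e = 2"
    using assms(1) by (auto simp: finite_graph_def)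
  have finK: "finite K"
    unfolding K_def using finV by (rule finite_graph_components)
  have equivR: "equiv V R" unfolding R_def by (rule equiv_connected_in)
  have K_eq: "K = V // R" by (simp add: K_def R_def graph_components_def)
  have inK: "R `` {v} \<in> K" if "v \<in> V" for v
    using that by (auto simp: K_eq intro: quotientI)
  have self: "v \<in> R `` {v}" if "v \<in> V" for v
    using that by (auto simp: R_def connected_in_def)
  have class_eq: "C = R `` {v}" if "C \<in> K" "v \<in> C" for C v
    using that equivR unfolding K_eq by (metis Image_singleton_iff equiv_class_eq quotientE)
  \<comment> \<open>\<open>F C\<close> is the set of signs allowed on the component
    \<open>C\<close>. Testing \<open>A\<close> before \<open>B\<close> creates no bias, because in
    the present case no component meets both; this is what \<open>F_B\<close> records.\<close>
  define F :: "'a set \<Rightarrow> real set" where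
    "F C = (if C \<inter> A \<noteq> {} then {1} else if C \<inter> B \<noteq> {} then {-1} else {-1, 1})" for C
  have F_B: "F C = {-1}" if "C \<in> K" "C \<inter> B \<noteq> {}" for C
  proof -
    from that(2) obtain b where b: "b \<in> C" "b \<in> B" by auto
    have "C \<inter> A = {}"
    proof (rule ccontr)
      assume "C \<inter> A \<noteq> {}"
      then obtain a where a: "a \<in> C" "a \<in> A" by auto
      have "(a, b) \<in> R"
        using class_eq[OF that(1) a(1)] b(1) by auto
      with a b True show False by (auto simp: R_def not_connected_sets_def)
    qed
    with that show ?thesis by (simp add: F_def)
  qed
  have repr: "(SOME v. v \<in> C) \<in> V \<and> R `` {SOME v. v \<in> C} = C" if "C \<in> K" for C
  proof -
    have "\<exists>v. v \<in> C" using that self unfolding K_eq by (auto elim!: quotientE)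
    then have "(SOME v. v \<in> C) \<in> C" by (rule someI_ex)
    moreover have "C \<subseteq> V" using that by (auto simp: K_eq R_def elim!: quotientE)
    ultimately show ?thesis using class_eq[OF that] by auto
  qed
  have const: "\<tau> u = \<tau> v" if "\<tau> \<in> ?T" "(u, v) \<in> R" for \<tau> u v
    using monochromatic_imp_eq_if_connected_in[of \<omega> \<tau> u v] that by (auto simp: R_def)
  \<comment> \<open>A colouring of components is pulled back to vertices along the class map; the
    inverse reads the sign at a chosen representative. Both directions are restricted so that the
    functions stay extensional.\<close>
  have "bij_betw (\<lambda>f. \<lambda>v\<in>V. f (R `` {v})) (PiE K F) ?T"
  proof (rule bij_betw_byWitness[where f' = "\<lambda>\<tau>. \<lambda>C\<in>K. \<tau> (SOME v. v \<in> C)"])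
    show "\<forall>f\<in>PiE K F. (\<lambda>C\<in>K. (\<lambda>v\<in>V. f (R `` {v})) (SOME v. v \<in> C)) = f"
    proof
      fix f assume f: "f \<in> PiE K F"
      show "(\<lambda>C\<in>K. (\<lambda>v\<in>V. f (R `` {v})) (SOME v. v \<in> C)) = f"
        using f repr by (intro extensionalityI[of _ K]) (auto simp: PiE_def)
    qed
    show "\<forall>\<tau>\<in>?T. (\<lambda>v\<in>V. (\<lambda>C\<in>K. \<tau> (SOME v. v \<in> C)) (R `` {v})) = \<tau>"
    proof
      fix \<tau> assume \<tau>: "\<tau> \<in> ?T"
      show "(\<lambda>v\<in>V. (\<lambda>C\<in>K. \<tau> (SOME v. v \<in> C)) (R `` {v})) = \<tau>"
      proof (rule extensionalityI[of _ V])
        show "\<tau> \<in> extensional V" using \<tau> by (auto simp: spins_def PiE_def)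
        fix v assume v: "v \<in> V"
        have "(v, SOME w. w \<in> R `` {v}) \<in> R"
          using self[OF v] by (metis Image_singleton_iff someI_ex)
        then show "(\<lambda>v\<in>V. (\<lambda>C\<in>K. \<tau> (SOME v. v \<in> C)) (R `` {v})) v = \<tau> v"
          using const[OF \<tau>] v inK[OF v] by auto
      qed auto
    qed
    show "(\<lambda>f. \<lambda>v\<in>V. f (R `` {v})) ` PiE K F \<subseteq> ?T"
    proof safe
      fix f assume f: "f \<in> PiE K F"
      have fF: "f (R `` {v}) \<in> F (R `` {v})" if "v \<in> V" for v
        using f inK[OF that] by (rule PiE_mem)
      have "f (R `` {v}) \<in> {-1, 1}" if "v \<in> V" for v
        using fF[OF that] by (auto simp: F_def split: if_splits)
      then show "(\<lambda>v\<in>V. f (R `` {v})) \<in> spins V" by (auto simp: spins_def)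
      show "(\<lambda>v\<in>V. f (R `` {v})) a = 1" if "a \<in> A" for a
      proof -
        from that assms(2) have a: "a \<in> V" by auto
        have "R `` {a} \<inter> A \<noteq> {}" using self[OF a] that by blast
        then have "F (R `` {a}) = {1}" by (simp add: F_def)
        with fF[OF a] a show ?thesis by simp
      qed
      show "(\<lambda>v\<in>V. f (R `` {v})) b = -1" if "b \<in> B" for b
      proof -
        from that assms(3) have b: "b \<in> V" by auto
        have "R `` {b} \<inter> B \<noteq> {}" using self[OF b] that by blast
        then have "F (R `` {b}) = {-1}" by (rule F_B[OF inK[OF b]])
        with fF[OF b] b show ?thesis by simp
      qed
      show "monochromatic (\<lambda>v\<in>V. f (R `` {v})) e" if e_in: "e \<in> \<omega>" for e
      proof -
        obtain p q where e: "e = {p, q}" "p \<in> V" "q \<in> V"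
          using edges[OF e_in] by (auto simp: card_2_iff)
        have "(p, q) \<in> R"
          using e e_in by (auto simp: R_def connected_in_def)
        then have "R `` {p} = R `` {q}" by (rule equiv_class_eq[OF equivR])
        with e show ?thesis by (auto simp: monochromatic_def)
      qed
    qed
    show "(\<lambda>\<tau>. \<lambda>C\<in>K. \<tau> (SOME v. v \<in> C)) ` ?T \<subseteq> PiE K F"
    proof (rule image_subsetI, rule PiE_I)
      fix \<tau> C assume \<tau>: "\<tau> \<in> ?T" and C: "C \<in> K"
      \<comment> \<open>The sign at the representative is the sign everywhere in \<open>C\<close>,
        so a constraint at any vertex of \<open>A\<close> or \<open>B\<close> inside
        \<open>C\<close> reaches it.\<close>
      have eq: "\<tau> (SOME v. v \<in> C) = \<tau> w" if "w \<in> C" for w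
        using const[OF \<tau>, of "SOME v. v \<in> C" w] repr[OF C] that by auto
      have "\<tau> (SOME v. v \<in> C) \<in> {-1, 1}"
        using \<tau> repr[OF C] spinsD[of \<tau> V] by auto
      moreover have "\<tau> (SOME v. v \<in> C) = 1" if "C \<inter> A \<noteq> {}"
        using that \<tau> eq by auto
      moreover have "\<tau> (SOME v. v \<in> C) = -1" if "C \<inter> B \<noteq> {}"
        using that \<tau> eq by auto
      ultimately show "(\<lambda>C\<in>K. \<tau> (SOME v. v \<in> C)) C \<in> F C"
        using C by (auto simp: F_def)
    qed auto
  qed
  then have "card ?T = card (PiE K F)" by (rule bij_betw_same_card[symmetric])
  also have "\<dots> = (\<Prod>C\<in>K. card (F C))" using finK by (rule card_PiE)
  also have "\<dots> = (\<Prod>C\<in>K. if C \<inter> (A \<union> B) \<noteq> {} then 1 else 2)"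
    by (intro prod.cong) (auto simp: F_def)
  also have "\<dots> = 2 ^ card {C \<in> K. C \<inter> (A \<union> B) = {}}"
    using finK by (simp add: prod.If_cases Int_def)
  finally have card: "card ?T = 2 ^ card {C \<in> K. C \<inter> (A \<union> B) = {}}" .
  \<comment> \<open>The exponent found above counts the components that avoid both sets; splitting
    off those that meet them turns it into a difference of the two component counts.\<close>
  have "num_components V \<omega> = card ({C \<in> K. C \<inter> (A \<union> B) = {}} \<union> {C \<in> K. C \<inter> (A \<union> B) \<noteq> {}})"
    unfolding num_components_def K_def[symmetric] by (rule arg_cong[of _ _ card]) auto
  also have "\<dots> = card {C \<in> K. C \<inter> (A \<union> B) = {}} + num_components_meeting V (A \<union> B) \<omega>"
    unfolding num_components_meeting_def K_def[symmetric]
    using finK by (intro card_Un_disjoint) auto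
  finally show ?thesis
    using True by (simp add: card power_add power_int_minus)
qed

subsection \<open>The sum over spins\<close>

text \<open>Double counting of incidences: the factor \<open>f v\<close> occurs once for every edge
  of \<open>\<eta>\<close> containing \<open>v\<close>.\<close>

lemma prod_edges_eq_prod_vertices:
  assumes "finite_graph V \<eta>"
  shows "(\<Prod>e\<in>\<eta>. \<Prod>v\<in>e. f v) = (\<Prod>v\<in>V. (f v :: 'a :: comm_semiring_1) ^ card {e \<in> \<eta>. v \<in> e})"
proof -
  have fin: "finite V" "finite \<eta>" and sub: "\<And>e. e \<in> \<eta> \<Longrightarrow> e \<subseteq> V"
    using assms finite_graph_finite_edges[OF assms] by (auto simp: finite_graph_def)
  have "(\<Prod>e\<in>\<eta>. \<Prod>v\<in>e. f v) = (\<Prod>e\<in>\<eta>. \<Prod>v\<in>{v \<in> V. v \<in> e}. f v)"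
    using sub by (intro prod.cong) auto
  also have "\<dots> = (\<Prod>v\<in>V. \<Prod>e\<in>{e \<in> \<eta>. v \<in> e}. f v)"
    using fin by (intro prod.swap_restrict)
  finally show ?thesis by simp
qed

text \<open>The handshake lemma, obtained from the previous identity with \<open>f\<close>
  constantly -1: every edge contributes (-1)(-1) = 1, while exactly the vertices of odd degree
  contribute -1.\<close>

lemma even_card_odd_vertices:
  assumes "finite_graph V \<eta>"
  shows "even (card (odd_vertices V \<eta>))"
proof -
  have fin: "finite V" using assms by (simp add: finite_graph_def)
  have "(1::real) = (\<Prod>e\<in>\<eta>. \<Prod>v\<in>e. -1)"
    using assms by (auto simp: finite_graph_def intro!: prod.neutral[symmetric])
  also have "\<dots> = (\<Prod>v\<in>V. (-1) ^ card {e \<in> \<eta>. v \<in> e})"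
    by (rule prod_edges_eq_prod_vertices[OF assms])
  also have "\<dots> = (\<Prod>v\<in>V. if odd (card {e \<in> \<eta>. v \<in> e}) then -1 else 1)"
    by (intro prod.cong) auto
  also have "\<dots> = (-1) ^ card (odd_vertices V \<eta>)"
    using fin by (simp add: prod.If_cases odd_vertices_def Int_def)
  finally show ?thesis by (metis neg_one_odd_power one_neq_neg_one)
qed

text \<open>The sum factorizes over vertices, and the sum of \<open>s ^ n\<close> over s = -1, 1 is
  2 for even \<open>n\<close> and 0 for odd \<open>n\<close>. Hence only an \<open>\<eta>\<close>
  whose odd vertices are exactly \<open>S\<close> survives.\<close>

lemma sum_spins_sources:
  assumes "finite_graph V \<eta>" "S \<subseteq> V"
  shows "(\<Sum>\<sigma>\<in>spins V. (\<Prod>v\<in>S. \<sigma> v) * (\<Prod>e\<in>\<eta>. \<Prod>v\<in>e. \<sigma> v))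
       = 2 ^ card V * of_bool (odd_vertices V \<eta> = S)"
proof -
  have fin: "finite V" using assms by (simp add: finite_graph_def)
  \<comment> \<open>The total power of \<open>\<sigma> v\<close> in the summand. It is even exactly
    when membership in \<open>S\<close> agrees with having odd degree in
    \<open>\<eta>\<close>.\<close>
  define n where "n v = of_bool (v \<in> S) + card {e \<in> \<eta>. v \<in> e}" for v
  have S: "(\<Prod>v\<in>S. \<sigma> v) = (\<Prod>v\<in>V. \<sigma> v ^ of_bool (v \<in> S))" for \<sigma> :: "'a \<Rightarrow> real"
  proof -
    have "(\<Prod>v\<in>S. \<sigma> v) = (\<Prod>v\<in>S. \<sigma> v ^ of_bool (v \<in> S))"
      by (intro prod.cong) auto
    also have "\<dots> = (\<Prod>v\<in>V. \<sigma> v ^ of_bool (v \<in> S))"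
      using fin assms(2) by (intro prod.mono_neutral_left) auto
    finally show ?thesis .
  qed
  have "(\<Sum>\<sigma>\<in>spins V. (\<Prod>v\<in>S. \<sigma> v) * (\<Prod>e\<in>\<eta>. \<Prod>v\<in>e. \<sigma> v))
      = (\<Sum>\<sigma>\<in>spins V. \<Prod>v\<in>V. \<sigma> v ^ n v)"
    by (simp only: S prod_edges_eq_prod_vertices[OF assms(1)] n_def power_add prod.distrib)
  also have "\<dots> = (\<Prod>v\<in>V. \<Sum>s\<in>{-1, 1}. s ^ n v)"
    unfolding spins_def using fin by (intro prod_sum_PiE[symmetric]) auto
  also have "\<dots> = (\<Prod>v\<in>V. 2 * of_bool (even (n v)))"
    by (intro prod.cong) auto
  also have "\<dots> = 2 ^ card V * of_bool (\<forall>v\<in>V. even (n v))"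
    using fin by (simp add: prod.distrib prod_of_bool)
  also have "(\<forall>v\<in>V. even (n v)) \<longleftrightarrow> odd_vertices V \<eta> = S"
    using assms(2) by (auto simp: n_def odd_vertices_def)
  finally show ?thesis .
qed

subsection \<open>The current expansion\<close>

text \<open>Serves in both directions of the change of variables, giving \<open>\<sigma>'\<close>
  from \<open>\<tau>\<close> and \<open>\<tau>\<close> from \<open>\<sigma>'\<close>. The
  restriction to \<open>V\<close> keeps the result extensional, as membership in
  \<open>spins V\<close> demands.\<close>

definition spin_product :: "'v set \<Rightarrow> ('v \<Rightarrow> real) \<Rightarrow> ('v \<Rightarrow> real) \<Rightarrow> 'v \<Rightarrow> real" where
  "spin_product V \<sigma> \<tau> = (\<lambda>v\<in>V. \<sigma> v * \<tau> v)"

lemma spin_product_in_spins: "\<sigma> \<in> spins V \<Longrightarrow> \<tau> \<in> spins V \<Longrightarrow> spin_product V \<sigma> \<tau> \<in> spins V"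
  unfolding spins_def spin_product_def
  by (rule restrict_PiE_iff[THEN iffD2]) (fastforce simp: PiE_iff)

lemma spin_product_cancel:
  assumes "\<sigma> \<in> spins V" "\<tau> \<in> spins V"
  shows "spin_product V \<sigma> (spin_product V \<sigma> \<tau>) = \<tau>"
proof (rule extensionalityI[of _ V])
  fix v assume "v \<in> V"
  then show "spin_product V \<sigma> (spin_product V \<sigma> \<tau>) v = \<tau> v"
    using spins_times_self[OF assms(1)] by (simp add: spin_product_def flip: mult.assoc)
qed (use assms in \<open>auto simp: spin_product_def spins_def PiE_def\<close>)

text \<open>For fixed \<open>\<sigma>\<close>, multiplication by \<open>\<sigma>\<close> is an
  involution of \<open>spins V\<close>, so it reindexes the inner sum.\<close>

lemma sum_spins_change_variables:
  "(\<Sum>s\<in>spins V \<times> spins V. f s) = (\<Sum>\<sigma>\<in>spins V. \<Sum>\<tau>\<in>spins V. f (\<sigma>, spin_product V \<sigma> \<tau>))"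
proof -
  have "(\<Sum>s\<in>spins V \<times> spins V. f s) = (\<Sum>\<sigma>\<in>spins V. \<Sum>\<sigma>'\<in>spins V. f (\<sigma>, \<sigma>'))"
    by (simp add: sum.cartesian_product)
  also have "\<dots> = (\<Sum>\<sigma>\<in>spins V. \<Sum>\<tau>\<in>spins V. f (\<sigma>, spin_product V \<sigma> \<tau>))"
  proof (rule sum.cong[OF refl])
    fix \<sigma> assume "\<sigma> \<in> spins V"
    then show "(\<Sum>\<sigma>'\<in>spins V. f (\<sigma>, \<sigma>')) = (\<Sum>\<tau>\<in>spins V. f (\<sigma>, spin_product V \<sigma> \<tau>))"
      by (intro sum.reindex_bij_witness[of _ "spin_product V \<sigma>" "spin_product V \<sigma>"])
         (auto simp: spin_product_cancel spin_product_in_spins)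
  qed
  finally show ?thesis .
qed

text \<open>Let s be the product of \<open>\<sigma>\<close> over \<open>e\<close>. If
  \<open>\<tau>\<close> agrees at the endpoints, both spin products equal s and the factor is exp(2U
  + 2Js) = exp(2U) (cosh 2J + s sinh 2J) = 1 + y + s x. Otherwise they are s and -s, the exponent
  vanishes and the factor is 1.\<close>

lemma AT_edge_factor:
  assumes "e \<subseteq> V" "card e = 2" "\<sigma> \<in> spins V" "\<tau> \<in> spins V"
  defines "\<sigma>' \<equiv> spin_product V \<sigma> \<tau>"
  shows "exp (J e * ((\<Prod>v\<in>e. \<sigma> v) + (\<Prod>v\<in>e. \<sigma>' v)) + U e * ((\<Prod>v\<in>e. \<sigma> v) * (\<Prod>v\<in>e. \<sigma>' v) + 1))
       = 1 + of_bool (monochromatic \<tau> e) * (x_weight J U e * (\<Prod>v\<in>e. \<sigma> v) + y_weight J U e)"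
proof -
  obtain p q where e: "e = {p, q}" "p \<noteq> q" "p \<in> V" "q \<in> V"
    using assms(1,2) by (auto simp: card_2_iff)
  \<comment> \<open>The cases s = 1 and s = -1 of the identity for monochromatic edges.\<close>
  have plus: "exp (2 * U e) * sinh (2 * J e) + exp (2 * U e) * cosh (2 * J e) = exp (J e * 2 + U e * 2)"
    by (simp only: sinh_plus_cosh flip: distrib_left exp_add) (simp add: algebra_simps)
  have minus: "exp (2 * U e) * cosh (2 * J e) - exp (2 * U e) * sinh (2 * J e) = exp (U e * 2 - J e * 2)"
    by (simp only: cosh_minus_sinh flip: right_diff_distrib exp_add) (simp add: algebra_simps)
  have prod_\<sigma>': "(\<Prod>v\<in>e. \<sigma>' v) = (\<Prod>v\<in>e. \<sigma> v) * (\<tau> p * \<tau> q)"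
    using e by (simp add: \<sigma>'_def spin_product_def)
  have mono: "monochromatic \<tau> e \<longleftrightarrow> \<tau> p = \<tau> q"
    using e(1) by (auto simp: monochromatic_def)
  have spin: "(\<Prod>v\<in>e. \<sigma> v) = 1 \<or> (\<Prod>v\<in>e. \<sigma> v) = -1"
    using spinsD[OF assms(3) e(3)] spinsD[OF assms(3) e(4)] e(1,2) by auto
  show ?thesis
  proof (cases "\<tau> p = \<tau> q")
    case True
    then have "\<tau> p * \<tau> q = 1" using spins_times_self[OF assms(4) e(4)] by simp
    with spin plus minus True show ?thesis
      unfolding prod_\<sigma>' mono x_weight_def y_weight_def by (elim disjE) (simp_all add: algebra_simps)
  next
    case False
    then have "\<tau> p * \<tau> q = -1"
      using spinsD[OF assms(4) e(3)] spinsD[OF assms(4) e(4)] by auto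
    with spin False show ?thesis
      unfolding prod_\<sigma>' mono by (elim disjE) simp_all
  qed
qed

text \<open>The product of binomials is expanded twice: \<open>\<omega>\<close> collects the edges
  where the term 1 is not taken, and within \<open>\<omega>\<close> the set \<open>\<eta>\<close>
  collects those where the x term is taken rather than the y term.\<close>

lemma AT_weight_expansion:
  assumes "finite_graph V E" "\<sigma> \<in> spins V" "\<tau> \<in> spins V"
  shows "AT_weight E J U (\<sigma>, spin_product V \<sigma> \<tau>)
       = (\<Sum>\<omega>\<in>Pow E. \<Sum>\<eta>\<in>Pow \<omega>. (\<Prod>e\<in>\<eta>. x_weight J U e) * (\<Prod>e\<in>\<omega> - \<eta>. y_weight J U e)
            * (\<Prod>e\<in>\<eta>. \<Prod>v\<in>e. \<sigma> v) * of_bool (\<forall>e\<in>\<omega>. monochromatic \<tau> e))"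
proof -
  have finE: "finite E" using assms(1) by (rule finite_graph_finite_edges)
  define c where "c e = (of_bool (monochromatic \<tau> e) :: real)" for e
  define z where "z e = x_weight J U e * (\<Prod>v\<in>e. \<sigma> v)" for e
  have "AT_weight E J U (\<sigma>, spin_product V \<sigma> \<tau>) = (\<Prod>e\<in>E. c e * (z e + y_weight J U e) + 1)"
    unfolding AT_weight_def prod.case c_def z_def
    using AT_edge_factor[OF _ _ assms(2,3)] assms(1)
    by (intro prod.cong) (auto simp: finite_graph_def)
  also have "\<dots> = (\<Sum>\<omega>\<in>Pow E. \<Prod>e\<in>\<omega>. c e * (z e + y_weight J U e))"
    using finE by (simp add: prod_add)
  also have "\<dots> = (\<Sum>\<omega>\<in>Pow E. (\<Prod>e\<in>\<omega>. c e) * (\<Sum>\<eta>\<in>Pow \<omega>. (\<Prod>e\<in>\<eta>. z e) * (\<Prod>e\<in>\<omega> - \<eta>. y_weight J U e)))"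
  proof (intro sum.cong refl)
    fix \<omega> assume "\<omega> \<in> Pow E"
    then have "finite \<omega>" using finE finite_subset by auto
    then show "(\<Prod>e\<in>\<omega>. c e * (z e + y_weight J U e))
        = (\<Prod>e\<in>\<omega>. c e) * (\<Sum>\<eta>\<in>Pow \<omega>. (\<Prod>e\<in>\<eta>. z e) * (\<Prod>e\<in>\<omega> - \<eta>. y_weight J U e))"
      by (simp only: prod.distrib prod_add)
  qed
  also have "\<dots> = (\<Sum>\<omega>\<in>Pow E. \<Sum>\<eta>\<in>Pow \<omega>. (\<Prod>e\<in>\<eta>. x_weight J U e) * (\<Prod>e\<in>\<omega> - \<eta>. y_weight J U e)
            * (\<Prod>e\<in>\<eta>. \<Prod>v\<in>e. \<sigma> v) * of_bool (\<forall>e\<in>\<omega>. monochromatic \<tau> e))"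
  proof (intro sum.cong refl)
    fix \<omega> assume "\<omega> \<in> Pow E"
    then have "finite \<omega>" using finE finite_subset by auto
    then have "(\<Prod>e\<in>\<omega>. c e) = of_bool (\<forall>e\<in>\<omega>. monochromatic \<tau> e)"
      unfolding c_def by (rule prod_of_bool)
    then show "(\<Prod>e\<in>\<omega>. c e) * (\<Sum>\<eta>\<in>Pow \<omega>. (\<Prod>e\<in>\<eta>. z e) * (\<Prod>e\<in>\<omega> - \<eta>. y_weight J U e))
       = (\<Sum>\<eta>\<in>Pow \<omega>. (\<Prod>e\<in>\<eta>. x_weight J U e) * (\<Prod>e\<in>\<omega> - \<eta>. y_weight J U e)
            * (\<Prod>e\<in>\<eta>. \<Prod>v\<in>e. \<sigma> v) * of_bool (\<forall>e\<in>\<omega>. monochromatic \<tau> e))"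
      by (simp only: z_def prod.distrib sum_distrib_left mult_ac)
  qed
  finally show ?thesis .
qed

lemma sum_currents:
  assumes "finite_graph V E"
  shows "(\<Sum>n\<in>currents V E S. f n)
       = (\<Sum>\<omega>\<in>Pow E. \<Sum>\<eta>\<in>Pow \<omega>. of_bool (odd_vertices V \<eta> = S) * (f (\<omega>, \<eta>) :: real))"
proof -
  have finE: "finite E" using assms by (rule finite_graph_finite_edges)
  have fin: "finite (Pow \<omega>)" if "\<omega> \<in> Pow E" for \<omega> using that finE finite_subset by auto
  \<comment> \<open>By the handshake lemma the source condition already forces an even number of
    sources, so the case distinction in \<open>currents\<close> reduces to that condition.\<close>
  have "even (card S)" if "odd_vertices V \<eta> = S" "\<eta> \<subseteq> \<omega>" "\<omega> \<subseteq> E" for \<omega> \<eta>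
    using that even_card_odd_vertices[OF finite_graph_subset[OF assms], of \<eta>] by auto
  then have eq: "currents V E S = {n \<in> Sigma (Pow E) Pow. odd_vertices V (snd n) = S}"
    unfolding currents_def by auto
  have "(\<Sum>n\<in>currents V E S. f n)
      = (\<Sum>n\<in>Sigma (Pow E) Pow. of_bool (odd_vertices V (snd n) = S) * f n)"
    unfolding eq using finE fin by (intro sum.mono_neutral_cong_left) auto
  also have "\<dots> = (\<Sum>\<omega>\<in>Pow E. \<Sum>\<eta>\<in>Pow \<omega>. of_bool (odd_vertices V \<eta> = S) * f (\<omega>, \<eta>))"
    using finE fin by (subst sum.Sigma) (auto intro!: sum.cong)
  finally show ?thesis .
qed

text \<open>For a fixed pair of edge sets the summand is a function of \<open>\<sigma>\<close> times
  a function of \<open>\<tau>\<close>. The \<open>\<sigma>\<close> sum yields the source constraint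
  and the factor \<open>2 ^ card V\<close>; the \<open>\<tau>\<close> sum yields the component
  factor of the current weight together with the correction for \<open>A\<close> and
  \<open>B\<close>.\<close>

lemma AT_current_expansion:
  assumes G: "finite_graph V E" and "S \<subseteq> V" "A \<subseteq> V" "B \<subseteq> V"
  shows "(\<Sum>\<sigma>\<in>spins V. \<Sum>\<tau>\<in>spins V. AT_weight E J U (\<sigma>, spin_product V \<sigma> \<tau>)
            * ((\<Prod>v\<in>S. \<sigma> v) * of_bool ((\<forall>a\<in>A. \<tau> a = 1) \<and> (\<forall>b\<in>B. \<tau> b = -1))))
       = 2 ^ card V * (\<Sum>(\<omega>, \<eta>)\<in>currents V E S. current_weight V J U (\<omega>, \<eta>)
            * 2 powi (- int (num_components_meeting V (A \<union> B) \<omega>))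
            * of_bool (not_connected_sets \<omega> A B))"
    (is "?L = ?R")
proof -
  have finV: "finite V" using G by (simp add: finite_graph_def)
  \<comment> \<open>\<open>X\<close> is the current weight without its component factor, while
    \<open>s\<close> and \<open>P\<close> gather everything that depends on \<open>\<sigma>\<close>
    and on \<open>\<tau>\<close> respectively.\<close>
  define X where "X \<omega> \<eta> = (\<Prod>e\<in>\<eta>. x_weight J U e) * (\<Prod>e\<in>\<omega> - \<eta>. y_weight J U e)" for \<omega> \<eta>
  define s where "s \<eta> \<sigma> = (\<Prod>v\<in>S. \<sigma> v) * (\<Prod>e\<in>\<eta>. \<Prod>v\<in>e. \<sigma> v)" for \<eta> and \<sigma> :: "'a \<Rightarrow> real"
  define P where "P \<omega> \<tau> \<longleftrightarrow> (\<forall>e\<in>\<omega>. monochromatic \<tau> e) \<and> (\<forall>a\<in>A. \<tau> a = 1) \<and> (\<forall>b\<in>B. \<tau> b = -1)"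
    for \<omega> and \<tau> :: "'a \<Rightarrow> real"
  have "?L = (\<Sum>\<sigma>\<in>spins V. \<Sum>\<tau>\<in>spins V. \<Sum>\<omega>\<in>Pow E. \<Sum>\<eta>\<in>Pow \<omega>. X \<omega> \<eta> * (s \<eta> \<sigma> * of_bool (P \<omega> \<tau>)))"
  proof (intro sum.cong refl)
    fix \<sigma> \<tau> assume "\<sigma> \<in> spins V" "\<tau> \<in> spins V"
    then show "AT_weight E J U (\<sigma>, spin_product V \<sigma> \<tau>)
            * ((\<Prod>v\<in>S. \<sigma> v) * of_bool ((\<forall>a\<in>A. \<tau> a = 1) \<and> (\<forall>b\<in>B. \<tau> b = -1)))
        = (\<Sum>\<omega>\<in>Pow E. \<Sum>\<eta>\<in>Pow \<omega>. X \<omega> \<eta> * (s \<eta> \<sigma> * of_bool (P \<omega> \<tau>)))"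
      by (simp only: AT_weight_expansion[OF G] X_def s_def P_def sum_distrib_left sum_distrib_right
          of_bool_conj mult_ac)
  qed
  also have "\<dots> = (\<Sum>\<omega>\<in>Pow E. \<Sum>\<eta>\<in>Pow \<omega>. \<Sum>\<sigma>\<in>spins V. \<Sum>\<tau>\<in>spins V. X \<omega> \<eta> * (s \<eta> \<sigma> * of_bool (P \<omega> \<tau>)))"
    \<comment> \<open>The edge-set sums move outside both spin sums, so that the latter can be
      separated by \<open>sum_product\<close>.\<close>
    unfolding sum.swap[of _ "Pow _" "spins V"] ..
  also have "\<dots> = (\<Sum>\<omega>\<in>Pow E. \<Sum>\<eta>\<in>Pow \<omega>. X \<omega> \<eta> * ((\<Sum>\<sigma>\<in>spins V. s \<eta> \<sigma>) * (\<Sum>\<tau>\<in>spins V. of_bool (P \<omega> \<tau>))))"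
    unfolding sum_product by (simp only: sum_distrib_left)
  also have "\<dots> = (\<Sum>\<omega>\<in>Pow E. \<Sum>\<eta>\<in>Pow \<omega>. 2 ^ card V * (of_bool (odd_vertices V \<eta> = S)
       * (current_weight V J U (\<omega>, \<eta>) * 2 powi (- int (num_components_meeting V (A \<union> B) \<omega>))
            * of_bool (not_connected_sets \<omega> A B))))"
  proof (intro sum.cong refl)
    fix \<omega> \<eta> assume "\<omega> \<in> Pow E" "\<eta> \<in> Pow \<omega>"
    then have g: "finite_graph V \<omega>" "finite_graph V \<eta>"
      using finite_graph_subset[OF G] by auto
    have "(\<Sum>\<tau>\<in>spins V. of_bool (P \<omega> \<tau>)) = real (card {\<tau> \<in> spins V. P \<omega> \<tau>})"
      using finite_spins[OF finV] by (simp add: Int_def)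
    also have "\<dots> = 2 ^ num_components V \<omega> * 2 powi (- int (num_components_meeting V (A \<union> B) \<omega>))
         * of_bool (not_connected_sets \<omega> A B)"
      unfolding P_def by (rule card_monochromatic_spins[OF g(1) assms(3,4)])
    finally show "X \<omega> \<eta> * ((\<Sum>\<sigma>\<in>spins V. s \<eta> \<sigma>) * (\<Sum>\<tau>\<in>spins V. of_bool (P \<omega> \<tau>)))
        = 2 ^ card V * (of_bool (odd_vertices V \<eta> = S)
       * (current_weight V J U (\<omega>, \<eta>) * 2 powi (- int (num_components_meeting V (A \<union> B) \<omega>))
            * of_bool (not_connected_sets \<omega> A B)))"
      unfolding s_def sum_spins_sources[OF g(2) assms(2)]
      by (simp only: X_def current_weight_def prod.case mult_ac)
  qed
  also have "\<dots> = ?R"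
    unfolding sum_currents[OF G] by (simp only: sum_distrib_left prod.case)
  finally show ?thesis .
qed

text \<open>With all three sets empty the observable is 1, no component is counted as meeting the
  empty set, and the separation condition is vacuous.\<close>

lemma AT_partition_eq_current_partition:
  assumes "finite_graph V E"
  shows "AT_partition V E J U = 2 ^ card V * current_partition V E J U"
  using AT_current_expansion[OF assms, of "{}" "{}" "{}" J U]
  by (simp add: AT_partition_def current_partition_def sum_spins_change_variables
      num_components_meeting_def not_connected_sets_def)

section \<open>Expectations as finite sums, and the observable in the new variables\<close>

lemma AT_weight_nonneg: "AT_weight E J U s \<ge> 0"
  by (auto simp: AT_weight_def split: prod.split intro!: prod_nonneg)

lemma AT_expectation_eq_sum:
  assumes "finite V"
  shows "AT_expectation V E J U f
       = (\<Sum>s\<in>spins V \<times> spins V. AT_weight E J U s * f s) / AT_partition V E J U"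
proof -
  \<comment> \<open>Nonnegativity of the density is what allows the integral over the point measure
    to be written as a real sum.\<close>
  have "AT_partition V E J U \<ge> 0"
    unfolding AT_partition_def by (intro sum_nonneg AT_weight_nonneg)
  then show ?thesis
    unfolding AT_expectation_def AT_measure_def
    using finite_spins[OF assms]
    by (subst lebesgue_integral_point_measure_finite)
       (auto simp: AT_weight_nonneg sum_divide_distrib intro!: sum.cong)
qed

text \<open>The factors (1 + t)/2 and (1 - t)/2 are the indicators of t = 1 and t = -1 for a sign
  t.\<close>

lemma phi_spin_product:
  assumes "\<tau> \<in> spins V" "v \<in> V"
  shows "phi (\<sigma>, spin_product V \<sigma> \<tau>) v = \<sigma> v * of_bool (\<tau> v = 1)"
    and "phi' (\<sigma>, spin_product V \<sigma> \<tau>) v = \<sigma> v * of_bool (\<tau> v = -1)"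
  using spinsD[OF assms] assms(2) by (auto simp: phi_def phi'_def spin_product_def)

text \<open>Squaring removes the spin, so \<open>A\<^sub>2\<close> and \<open>B\<^sub>2\<close>
  contribute only indicators on \<open>\<tau>\<close>. The spins left over \<open>A\<^sub>1\<close>
  and \<open>B\<^sub>1\<close> merge into one product because these sets are disjoint, and their
  union becomes the source set.\<close>

lemma phi_phi'_spin_product:
  assumes "finite V" and \<sigma>: "\<sigma> \<in> spins V" and \<tau>: "\<tau> \<in> spins V"
    and sub: "A\<^sub>1 \<subseteq> V" "A\<^sub>2 \<subseteq> V" "B\<^sub>1 \<subseteq> V" "B\<^sub>2 \<subseteq> V" and "A\<^sub>1 \<inter> B\<^sub>1 = {}"
  defines "s \<equiv> (\<sigma>, spin_product V \<sigma> \<tau>)"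
  shows "(\<Prod>v\<in>A\<^sub>1. phi s v) * (\<Prod>v\<in>A\<^sub>2. (phi s v)\<^sup>2) * (\<Prod>v\<in>B\<^sub>1. phi' s v) * (\<Prod>v\<in>B\<^sub>2. (phi' s v)\<^sup>2)
       = (\<Prod>v\<in>A\<^sub>1 \<union> B\<^sub>1. \<sigma> v)
         * of_bool ((\<forall>a\<in>A\<^sub>1 \<union> A\<^sub>2. \<tau> a = 1) \<and> (\<forall>b\<in>B\<^sub>1 \<union> B\<^sub>2. \<tau> b = -1))"
proof -
  have fin: "finite A\<^sub>1" "finite A\<^sub>2" "finite B\<^sub>1" "finite B\<^sub>2"
    using sub assms(1) by (auto intro: finite_subset)
  have "(\<Prod>v\<in>A\<^sub>1. phi s v) = (\<Prod>v\<in>A\<^sub>1. \<sigma> v * of_bool (\<tau> v = 1))"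
    unfolding s_def using sub by (intro prod.cong refl phi_spin_product \<tau>) auto
  moreover have "(\<Prod>v\<in>B\<^sub>1. phi' s v) = (\<Prod>v\<in>B\<^sub>1. \<sigma> v * of_bool (\<tau> v = -1))"
    unfolding s_def using sub by (intro prod.cong refl phi_spin_product \<tau>) auto
  moreover have "(\<Prod>v\<in>A\<^sub>2. (phi s v)\<^sup>2) = (\<Prod>v\<in>A\<^sub>2. of_bool (\<tau> v = 1))"
  proof (intro prod.cong refl)
    fix v assume "v \<in> A\<^sub>2"
    then have v: "v \<in> V" using sub by auto
    show "(phi s v)\<^sup>2 = of_bool (\<tau> v = 1)"
      unfolding s_def phi_spin_product[OF \<tau> v] using spinsD[OF \<sigma> v] by auto
  qed
  moreover have "(\<Prod>v\<in>B\<^sub>2. (phi' s v)\<^sup>2) = (\<Prod>v\<in>B\<^sub>2. of_bool (\<tau> v = -1))"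
  proof (intro prod.cong refl)
    fix v assume "v \<in> B\<^sub>2"
    then have v: "v \<in> V" using sub by auto
    show "(phi' s v)\<^sup>2 = of_bool (\<tau> v = -1)"
      unfolding s_def phi_spin_product[OF \<tau> v] using spinsD[OF \<sigma> v] by auto
  qed
  ultimately show ?thesis
    using fin assms(8)
    by (simp only: prod.distrib prod_of_bool prod.union_disjoint ball_Un of_bool_conj mult_ac)
qed

theorem proposition3:
  fixes V :: "'v set" and E :: "'v set set"
    and J U :: "'v set \<Rightarrow> real"
    and A\<^sub>1 A\<^sub>2 B\<^sub>1 B\<^sub>2 A B :: "'v set"
  assumes "finite_graph V E"
    and "A\<^sub>1 \<subseteq> V" "A\<^sub>2 \<subseteq> V" "B\<^sub>1 \<subseteq> V" "B\<^sub>2 \<subseteq> V"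
    and "A\<^sub>1 \<inter> A\<^sub>2 = {}" "A\<^sub>1 \<inter> B\<^sub>1 = {}" "A\<^sub>1 \<inter> B\<^sub>2 = {}"
        "A\<^sub>2 \<inter> B\<^sub>1 = {}" "A\<^sub>2 \<inter> B\<^sub>2 = {}" "B\<^sub>1 \<inter> B\<^sub>2 = {}"
    and "A = A\<^sub>1 \<union> A\<^sub>2" and "B = B\<^sub>1 \<union> B\<^sub>2"
  shows "AT_expectation V E J U
           (\<lambda>s. (\<Prod>v\<in>A\<^sub>1. phi s v) * (\<Prod>v\<in>A\<^sub>2. (phi s v)\<^sup>2)
                * (\<Prod>v\<in>B\<^sub>1. phi' s v) * (\<Prod>v\<in>B\<^sub>2. (phi' s v)\<^sup>2))
         = 1 / current_partition V E J U
           * (\<Sum>(\<omega>, \<eta>) \<in> currents V E (A\<^sub>1 \<union> B\<^sub>1).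
                current_weight V J U (\<omega>, \<eta>)
                * 2 powi (- int (num_components_meeting V (A \<union> B) \<omega>))
                * of_bool (not_connected_sets \<omega> A B))"
proof -
  have finV: "finite V" using assms(1) by (simp add: finite_graph_def)
  let ?f = "\<lambda>s. (\<Prod>v\<in>A\<^sub>1. phi s v) * (\<Prod>v\<in>A\<^sub>2. (phi s v)\<^sup>2)
                * (\<Prod>v\<in>B\<^sub>1. phi' s v) * (\<Prod>v\<in>B\<^sub>2. (phi' s v)\<^sup>2)"
  let ?C = "\<Sum>(\<omega>, \<eta>) \<in> currents V E (A\<^sub>1 \<union> B\<^sub>1). current_weight V J U (\<omega>, \<eta>)
                * 2 powi (- int (num_components_meeting V (A \<union> B) \<omega>))
                * of_bool (not_connected_sets \<omega> A B)"
  have "(\<Sum>s\<in>spins V \<times> spins V. AT_weight E J U s * ?f s)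
      = (\<Sum>\<sigma>\<in>spins V. \<Sum>\<tau>\<in>spins V. AT_weight E J U (\<sigma>, spin_product V \<sigma> \<tau>)
            * ((\<Prod>v\<in>A\<^sub>1 \<union> B\<^sub>1. \<sigma> v) * of_bool ((\<forall>a\<in>A. \<tau> a = 1) \<and> (\<forall>b\<in>B. \<tau> b = -1))))"
    unfolding sum_spins_change_variables \<open>A = _\<close> \<open>B = _\<close>
    by (intro sum.cong refl arg_cong2[of _ _ _ _ "(*)"]
          phi_phi'_spin_product[OF finV _ _ assms(2-5,7)])
  also have "\<dots> = 2 ^ card V * ?C"
    using assms by (intro AT_current_expansion) auto
  \<comment> \<open>The factor \<open>2 ^ card V\<close> appears in both the numerator and the
    partition function and cancels.\<close>
  finally show ?thesis
    unfolding AT_expectation_eq_sum[OF finV] AT_partition_eq_current_partition[OF assms(1)]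
    by simp
qed

end
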